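(* Let $H$ be a graph with $o(H)=\mathcal{S}$ and let $G$ be a connected graph with $n(G)\geq 2$. Then $\gamma_{\mathrm{SMB}}(G\odot H)=\gamma_{\mathrm{SMB}}'(G\odot H)=1+\gamma_{\mathrm{SMB}}(H)$.
   Context: All graphs are finite and simple; $n(G)$ denotes the order of $G$. The Maker-Breaker domination game on a graph $G$: Dominator and Staller alternately select a not yet selected vertex of $G$. Dominator wins if his selected vertices contain a dominating set of $G$; Staller wins if she selects at least one vertex from every dominating set of $G$. In the D-game Dominator moves first, in the S-game Staller moves first. $\gamma_{\mathrm{SMB}}(G)$ (resp. $\gamma_{\mathrm{SMB}}'(G)$) is the minimum number of moves Staller needs to win the D-game (resp. S-game) on $G$ when both players play optimally, and is $\infty$ if Staller has no winning strategy. The outcome $o(G)=\mathcal{S}$ means Staller has a winning strategy in both the D-game and the S-game. The corona $G\odot H$ is obtained from one copy of $G$ and $n(G)$ disjoint copies of $H$ by joining the $i$-th vertex of $G$ to every vertex of the $i$-th copy of $H$. *)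

theory Defs
  imports "Graph_Theory.Digraph_Component" "HOL-Library.Extended_Nat"
begin

text \<open>
  A finite simple graph is a \<^locale>\<open>pair_graph\<close>: a finite, symmetric, loop-free digraph whose
  arcs are pairs of vertices. The null graph is allowed; \<^const>\<open>connected\<close> excludes it.
\<close>

definition dominating_set :: "'a pair_pre_digraph \<Rightarrow> 'a set \<Rightarrow> bool" where
  "dominating_set G D \<longleftrightarrow>
     D \<subseteq> pverts G \<and> (\<forall>v \<in> pverts G - D. \<exists>u \<in> D. (u, v) \<in> parcs G)"

datatype player = Dominator | Staller

fun opponent :: "player \<Rightarrow> player" where
  "opponent Dominator = Staller"
| "opponent Staller = Dominator"

definition to_move :: "player \<Rightarrow> nat \<Rightarrow> player" where
  "to_move first i = (if even i then first else opponent first)"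

text \<open>
  A strategy maps the history of the game (all moves of both players, in chronological order) to
  the next vertex. It is legal if it answers every history that leaves some vertex unselected
  with an unselected vertex.
\<close>

type_synonym 'a strategy = "'a list \<Rightarrow> 'a"

definition legal_strategy :: "'a pair_pre_digraph \<Rightarrow> 'a strategy \<Rightarrow> bool" where
  "legal_strategy G s \<longleftrightarrow>
     (\<forall>h. distinct h \<and> set h \<subset> pverts G \<longrightarrow> s h \<in> pverts G - set h)"

text \<open>
  The first \<open>n\<close> moves when Dominator uses \<open>d\<close> and Staller uses \<open>s\<close>. This is only meaningful for
  \<open>n \<le> card (pverts G)\<close>, since afterwards no vertex is left to select.
\<close>

fun play :: "player \<Rightarrow> 'a strategy \<Rightarrow> 'a strategy \<Rightarrow> nat \<Rightarrow> 'a list" where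
  "play first d s 0 = []"
| "play first d s (Suc n) =
     (let h = play first d s n
      in h @ [case to_move first n of Dominator \<Rightarrow> d h | Staller \<Rightarrow> s h])"

definition selected :: "player \<Rightarrow> player \<Rightarrow> 'a list \<Rightarrow> 'a set" where
  "selected first p h = {h ! i | i. i < length h \<and> to_move first i = p}"

definition staller_won :: "'a pair_pre_digraph \<Rightarrow> player \<Rightarrow> 'a list \<Rightarrow> bool" where
  "staller_won G first h \<longleftrightarrow>
     (\<forall>D. dominating_set G D \<longrightarrow> selected first Staller h \<inter> D \<noteq> {})"

definition staller_has_winning_strategy :: "'a pair_pre_digraph \<Rightarrow> player \<Rightarrow> bool" where
  "staller_has_winning_strategy G first \<longleftrightarrow>
     (\<exists>s. legal_strategy G s \<and>
        (\<forall>d. legal_strategy G d \<longrightarrow>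
           (\<exists>n \<le> card (pverts G). staller_won G first (play first d s n))))"

text \<open>As \<open>staller_has_winning_strategy\<close>, but Staller has made at most \<open>k\<close> moves when she wins.\<close>

definition staller_can_win_within :: "'a pair_pre_digraph \<Rightarrow> player \<Rightarrow> nat \<Rightarrow> bool" where
  "staller_can_win_within G first k \<longleftrightarrow>
     (\<exists>s. legal_strategy G s \<and>
        (\<forall>d. legal_strategy G d \<longrightarrow>
           (\<exists>n \<le> card (pverts G). staller_won G first (play first d s n) \<and>
              card (selected first Staller (play first d s n)) \<le> k)))"

text \<open>
  \<open>gamma_SMB\<close> belongs to the D-game, \<open>gamma_SMB'\<close> to the S-game. The infimum of the empty set
  in \<^typ>\<open>enat\<close> is \<open>\<infinity>\<close>.
\<close>

definition gamma_SMB :: "'a pair_pre_digraph \<Rightarrow> enat" where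
  "gamma_SMB G = Inf {enat k | k. staller_can_win_within G Dominator k}"

definition gamma_SMB' :: "'a pair_pre_digraph \<Rightarrow> enat" where
  "gamma_SMB' G = Inf {enat k | k. staller_can_win_within G Staller k}"

definition outcome_S :: "'a pair_pre_digraph \<Rightarrow> bool" where
  "outcome_S G \<longleftrightarrow>
     staller_has_winning_strategy G Dominator \<and> staller_has_winning_strategy G Staller"

text \<open>
  \<open>Inl g\<close> is the vertex \<open>g\<close> of \<open>G\<close>, and \<open>Inr (g, x)\<close> is the vertex \<open>x\<close> in the copy of \<open>H\<close>
  attached to \<open>g\<close>.
\<close>

definition corona ::
  "'a pair_pre_digraph \<Rightarrow> 'b pair_pre_digraph \<Rightarrow> ('a + 'a \<times> 'b) pair_pre_digraph"
  (infixl \<open>\<odot>\<close> 70) where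
  "G \<odot> H =
     \<lparr> pverts = Inl ` pverts G \<union> Inr ` (pverts G \<times> pverts H),
       parcs = {(Inl g, Inl g') | g g'. (g, g') \<in> parcs G}
         \<union> {(Inr (g, x), Inr (g, y)) | g x y. g \<in> pverts G \<and> (x, y) \<in> parcs H}
         \<union> {(Inl g, Inr (g, x)) | g x. g \<in> pverts G \<and> x \<in> pverts H}
         \<union> {(Inr (g, x), Inl g) | g x. g \<in> pverts G \<and> x \<in> pverts H} \<rparr>"

lemma pair_graph_corona:
  assumes "pair_graph G" and "pair_graph H"
  shows "pair_graph (G \<odot> H)"
proof -
  interpret G: pair_graph G by fact
  interpret H: pair_graph H by fact
  have symG: "(b, a) \<in> parcs G" if "(a, b) \<in> parcs G" for a b
    using G.pair_sym_arcs that by (auto simp: symmetric_def sym_def)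
  have symH: "(b, a) \<in> parcs H" if "(a, b) \<in> parcs H" for a b
    using H.pair_sym_arcs that by (auto simp: symmetric_def sym_def)
  have wf: "parcs (G \<odot> H) \<subseteq> pverts (G \<odot> H) \<times> pverts (G \<odot> H)"
    by (auto simp: corona_def dest: G.in_arcsD1 G.in_arcsD2 H.in_arcsD1 H.in_arcsD2)
  have fin: "finite (pverts (G \<odot> H))"
    by (simp add: corona_def G.pair_finite_verts H.pair_finite_verts)
  show ?thesis
  proof unfold_locales
    show "finite (parcs (G \<odot> H))"
      using wf fin by (meson finite_SigmaI finite_subset)
    show "symmetric (G \<odot> H)"
      by (auto simp: symmetric_def sym_def corona_def symG symH)
    show "fst e \<noteq> snd e" if "e \<in> parcs (G \<odot> H)" for e
      using that G.pair_no_loops H.pair_no_loops by (fastforce simp: corona_def)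
  qed (use wf fin in auto)
qed

end

theory Submission
  imports Defs
begin

text \<open>
  Staller wins exactly when she owns a closed neighbourhood; in the corona this means owning a
  vertex \<open>g\<close> of \<open>G\<close> together with a closed neighbourhood in the copy of \<open>H\<close> at \<open>g\<close>. For the upper
  bound Staller first takes a vertex \<open>g\<close> whose copy Dominator has not touched and then plays the
  D-game in this copy. For the lower bound Dominator answers a first Staller move inside the copy
  at \<open>g\<close> by taking \<open>g\<close>, which kills the copy, and answers the move \<open>g\<close> by opening the D-game in
  the copy.
\<close>

section \<open>Strategies and positions\<close>

definition owns_closed_nbhd :: "'a pair_pre_digraph \<Rightarrow> 'a set \<Rightarrow> bool" where
  "owns_closed_nbhd G S \<longleftrightarrow> (\<exists>v \<in> pverts G \<inter> S. \<forall>u. (u, v) \<in> parcs G \<longrightarrow> u \<in> S)"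

text \<open>A dominating set missing Staller's vertices lies in their complement, and supersets of
  dominating sets dominate, so only the complement has to be tested. A vertex it fails to dominate
  has its whole closed neighbourhood on Staller's side.\<close>

lemma staller_won_iff:
  assumes "pair_graph G"
  shows "staller_won G first h \<longleftrightarrow> owns_closed_nbhd G (selected first Staller h)"
proof -
  interpret pair_graph G by fact
  let ?S = "selected first Staller h"
  have "staller_won G first h \<longleftrightarrow> \<not> dominating_set G (pverts G - ?S)"
    unfolding staller_won_def dominating_set_def by blast
  also have "\<dots> \<longleftrightarrow> owns_closed_nbhd G ?S"
    unfolding dominating_set_def owns_closed_nbhd_def using in_arcsD1 by blast
  finally show ?thesis .
qed

section \<open>Forced wins as an abstract positional game\<close>

text \<open>
  Staller is to move, owns \<open>S\<close>, and wins within \<open>k\<close> further moves of hers on the free vertices \<open>A\<close>.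
  Dominator's reply \<open>d\<close> need not be free, so he is allowed to pass; this costs Staller nothing.
\<close>

fun staller_forces :: "('a set \<Rightarrow> bool) \<Rightarrow> nat \<Rightarrow> 'a set \<Rightarrow> 'a set \<Rightarrow> bool" where
  "staller_forces W 0 S A \<longleftrightarrow> W S"
| "staller_forces W (Suc k) S A \<longleftrightarrow>
     W S \<or> (\<exists>s \<in> A. \<forall>d. staller_forces W k (insert s S) (A - {s} - {d}))"

lemma staller_forces_won: "W S \<Longrightarrow> staller_forces W k S A"
  by (cases k) auto

lemma staller_forces_empty: "staller_forces W k S {} \<Longrightarrow> W S"
  by (cases k) auto

lemma staller_forces_mono:
  "staller_forces W k S A \<Longrightarrow> k \<le> l \<Longrightarrow> A \<subseteq> B \<Longrightarrow> staller_forces W l S B"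
proof (induction k arbitrary: l S A B)
  case 0
  then show ?case by (simp add: staller_forces_won)
next
  case (Suc k)
  obtain m where l: "l = Suc m" "k \<le> m"
    using Suc.prems(2) by (cases l) auto
  show ?case
  proof (cases "W S")
    case False
    then obtain s where s: "s \<in> A" "\<And>d. staller_forces W k (insert s S) (A - {s} - {d})"
      using Suc.prems(1) by auto
    have "staller_forces W m (insert s S) (B - {s} - {d})" for d
      by (rule Suc.IH[OF s(2) l(2)]) (use Suc.prems(3) in auto)
    then show ?thesis
      using s(1) Suc.prems(3) l(1) by auto
  qed (simp add: staller_forces_won)
qed

text \<open>Staller plays the small game through \<open>f\<close> inside a larger board, where she
  already owns \<open>E\<close>.\<close>

lemma staller_forces_embed:
  assumes "inj f" and "\<And>S. W S \<Longrightarrow> W' (f ` S \<union> E)"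
  shows "staller_forces W k S A \<Longrightarrow> f ` A \<subseteq> B \<Longrightarrow> staller_forces W' k (f ` S \<union> E) B"
proof (induction k arbitrary: S A B)
  case 0
  then show ?case using assms(2) by simp
next
  case (Suc k)
  show ?case
  proof (cases "W S")
    case True
    then show ?thesis using assms(2) by (simp add: staller_forces_won)
  next
    case False
    then obtain s where s: "s \<in> A" "\<And>d. staller_forces W k (insert s S) (A - {s} - {d})"
      using Suc.prems(1) by auto
    have "staller_forces W' k (insert (f s) (f ` S \<union> E)) (B - {f s} - {d})" for d
    proof -
      \<comment> \<open>A reply \<open>d\<close> outside the range of \<open>f\<close> is pulled
        back to an arbitrary point; this is harmless because replies in the small game are
        unrestricted.\<close>
      have "f ` (A - {s} - {inv f d}) \<subseteq> B - {f s} - {d}"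
        using Suc.prems(2) assms(1) by (auto simp: inj_def)
      from Suc.IH[OF s(2) this] show ?thesis by simp
    qed
    then show ?thesis
      using s(1) Suc.prems(2) by auto
  qed
qed

section \<open>Positions reached by histories, and single moves\<close>

text \<open>\<open>card S\<close> counts the moves Staller has used. The conjunct
  \<open>card S \<le> k\<close> keeps the truncated subtraction from hiding an exceeded
  budget.\<close>

definition winning_pos :: "'a pair_pre_digraph \<Rightarrow> player \<Rightarrow> nat \<Rightarrow> 'a list \<Rightarrow> bool" where
  "winning_pos G first k h \<longleftrightarrow>
     (let S = selected first Staller h; A = pverts G - set h;
          F = staller_forces (owns_closed_nbhd G) (k - card S) S
      in card S \<le> k \<and> (if to_move first (length h) = Staller then F A else (\<forall>d. F (A - {d}))))"

lemma selected_append: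
  "selected first p (h @ [x]) =
     (if to_move first (length h) = p then insert x (selected first p h) else selected first p h)"
proof -
  have img: "selected first p l = (!) l ` {i. i < length l \<and> to_move first i = p}" for l
    unfolding selected_def by blast
  have "{i. i < length (h @ [x]) \<and> to_move first i = p} =
      (if to_move first (length h) = p then {length h} else {}) \<union>
      {i. i < length h \<and> to_move first i = p}"
    by (auto simp: less_Suc_eq)
  then have "selected first p (h @ [x]) = (if to_move first (length h) = p then {x} else {}) \<union>
      (!) (h @ [x]) ` {i. i < length h \<and> to_move first i = p}"
    by (simp add: img image_Un)
  also have "(!) (h @ [x]) ` {i. i < length h \<and> to_move first i = p} = selected first p h"
    unfolding img[of h] by (rule image_cong) (auto simp: nth_append)
  finally show ?thesis by auto
qed

lemma selected_subset: "selected first p h \<subseteq> set h"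
  by (auto simp: selected_def)

lemma card_selected_append:
  assumes "x \<notin> set h"
  shows "card (selected first p (h @ [x])) =
    (if to_move first (length h) = p then Suc (card (selected first p h))
     else card (selected first p h))"
proof -
  have "x \<notin> selected first p h" "finite (selected first p h)"
    using assms selected_subset[of first p h] by (auto intro: finite_subset)
  then show ?thesis
    by (simp add: selected_append)
qed

lemma to_move_Suc: "to_move first (Suc n) = opponent (to_move first n)"
  by (cases first) (auto simp: to_move_def)

lemma winning_pos_won:
  assumes "owns_closed_nbhd G (selected first Staller h)" "card (selected first Staller h) \<le> k"
  shows "winning_pos G first k h"
  using assms by (simp add: winning_pos_def Let_def staller_forces_won)

lemma winning_pos_Staller_move:
  assumes "to_move first (length h) = Staller" and "winning_pos G first k h"
    and "\<not> owns_closed_nbhd G (selected first Staller h)"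
  shows "\<exists>s \<in> pverts G - set h. winning_pos G first k (h @ [s])"
proof -
  let ?S = "selected first Staller h" and ?A = "pverts G - set h"
  let ?F = "staller_forces (owns_closed_nbhd G)"
  have F: "?F (k - card ?S) ?S ?A"
    using assms(1,2) by (simp add: winning_pos_def Let_def)
  \<comment> \<open>With no move left, a forced win would mean that she has already won.\<close>
  then obtain j where j: "k - card ?S = Suc j"
    using assms(3) by (cases "k - card ?S") auto
  with F assms(3) obtain s where s: "s \<in> ?A" "\<And>d. ?F j (insert s ?S) (?A - {s} - {d})"
    by auto
  have "k - Suc (card ?S) = j" "Suc (card ?S) \<le> k"
    using j by auto
  moreover have "pverts G - insert s (set h) = ?A - {s}" by blast
  ultimately have "winning_pos G first k (h @ [s])"
    using s assms(1) card_selected_append[of s h first Staller]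
    by (simp add: winning_pos_def selected_append to_move_Suc)
  then show ?thesis using s(1) by blast
qed

lemma winning_pos_Dominator_move:
  assumes "to_move first (length h) = Dominator" and "winning_pos G first k h"
  shows "winning_pos G first k (h @ [d])"
proof -
  have "pverts G - insert d (set h) = pverts G - set h - {d}" by blast
  then show ?thesis
    using assms by (simp add: winning_pos_def selected_append to_move_Suc Let_def)
qed

lemma not_winning_pos_Staller_move:
  assumes "to_move first (length h) = Staller" and "\<not> winning_pos G first k h"
    and s: "s \<in> pverts G - set h"
  shows "\<not> winning_pos G first k (h @ [s])"
proof
  assume w: "winning_pos G first k (h @ [s])"
  let ?S = "selected first Staller h" and ?A = "pverts G - set h"
  let ?F = "staller_forces (owns_closed_nbhd G)"
  have c: "card (insert s ?S) = Suc (card ?S)"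
    using card_selected_append[of s h first Staller] s assms(1) by (simp add: selected_append)
  have "pverts G - insert s (set h) = ?A - {s}" by blast
  then have "Suc (card ?S) \<le> k"
    and F: "\<And>d. ?F (k - Suc (card ?S)) (insert s ?S) (?A - {s} - {d})"
    using w assms(1) c by (auto simp: winning_pos_def selected_append to_move_Suc Let_def)
  then have "k - card ?S = Suc (k - Suc (card ?S))" by simp
  then have "?F (k - card ?S) ?S ?A"
    using F s by auto
  then show False
    using assms(1,2) \<open>Suc (card ?S) \<le> k\<close> by (simp add: winning_pos_def Let_def)
qed

text \<open>The saving reply may be a pass, but the history needs a free vertex. Any free vertex
  \<open>e\<close> serves in place of a pass, since a Staller win without \<open>e\<close> gives one
  on the full set of free vertices by monotonicity.\<close>

lemma not_winning_pos_Dominator_move: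
  assumes "to_move first (length h) = Dominator" and "\<not> winning_pos G first k h"
    and "set h \<subset> pverts G"
  shows "\<exists>d \<in> pverts G - set h. \<not> winning_pos G first k (h @ [d])"
proof (rule ccontr)
  assume "\<not> ?thesis"
  then have w: "\<And>d. d \<in> pverts G - set h \<Longrightarrow> winning_pos G first k (h @ [d])"
    by blast
  let ?S = "selected first Staller h" and ?A = "pverts G - set h"
  let ?F = "staller_forces (owns_closed_nbhd G) (k - card ?S) ?S"
  have *: "card ?S \<le> k \<and> ?F (?A - {d})" if "d \<in> ?A" for d
  proof -
    have "pverts G - insert d (set h) = ?A - {d}" by blast
    then show ?thesis
      using w[OF that] assms(1)
      by (simp add: winning_pos_def selected_append to_move_Suc Let_def)
  qed
  obtain e where e: "e \<in> ?A" using assms(3) by blast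
  have "?F (?A - {d})" for d
  proof (cases "d \<in> ?A")
    case False
    have "?F (?A - {e})" using * e by blast
    then show ?thesis by (rule staller_forces_mono) (use False in auto)
  qed (use * in blast)
  then show False
    using assms(1,2) * e by (simp add: winning_pos_def Let_def)
qed

section \<open>From positions to strategies\<close>

text \<open>The second disjunct lets the choice fall back on any free vertex, so the strategy is
  legal for every \<open>P\<close>. Staller uses it with winning positions, Dominator with their
  complement.\<close>

definition preferring :: "'a pair_pre_digraph \<Rightarrow> ('a list \<Rightarrow> bool) \<Rightarrow> 'a strategy" where
  "preferring G P h = (SOME v. v \<in> pverts G - set h \<and>
     (P (h @ [v]) \<or> \<not> (\<exists>u \<in> pverts G - set h. P (h @ [u]))))"

lemma preferring:
  assumes "set h \<subset> pverts G"
  shows "preferring G P h \<in> pverts G - set h"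
    and "\<exists>u \<in> pverts G - set h. P (h @ [u]) \<Longrightarrow> P (h @ [preferring G P h])"
proof -
  have "\<exists>v. v \<in> pverts G - set h \<and> (P (h @ [v]) \<or> \<not> (\<exists>u \<in> pverts G - set h. P (h @ [u])))"
    using assms by blast
  from someI_ex[OF this] show "preferring G P h \<in> pverts G - set h"
    and "\<exists>u \<in> pverts G - set h. P (h @ [u]) \<Longrightarrow> P (h @ [preferring G P h])"
    unfolding preferring_def by blast+
qed

lemma legal_preferring: "legal_strategy G (preferring G P)"
  unfolding legal_strategy_def by (intro allI impI preferring(1)) (elim conjE)

lemma length_play [simp]: "length (play first d s n) = n"
  by (induction n) (auto simp: Let_def)

lemma legal_play:
  assumes "legal_strategy G d" "legal_strategy G s" "finite (pverts G)"
  shows "n \<le> card (pverts G) \<Longrightarrow>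
    distinct (play first d s n) \<and> set (play first d s n) \<subseteq> pverts G"
proof (induction n)
  case (Suc n)
  let ?h = "play first d s n"
  have h: "distinct ?h" "set ?h \<subseteq> pverts G" using Suc by auto
  then have "card (set ?h) = n" by (simp add: distinct_card)
  then have "set ?h \<subset> pverts G" using h Suc.prems by auto
  then have "d ?h \<in> pverts G - set ?h" "s ?h \<in> pverts G - set ?h"
    using assms h unfolding legal_strategy_def by blast+
  then show ?case
    using h by (auto simp: Let_def split: player.splits)
qed simp

lemma play_proper:
  assumes "legal_strategy G d" "legal_strategy G s" "finite (pverts G)" "n < card (pverts G)"
  shows "set (play first d s n) \<subset> pverts G"
proof -
  have h: "distinct (play first d s n)" "set (play first d s n) \<subseteq> pverts G"
    using legal_play[OF assms(1-3)] assms(4) by auto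
  then have "card (set (play first d s n)) = n" by (simp add: distinct_card)
  then show ?thesis using h assms(4) by auto
qed

text \<open>Each player can preserve the kind of position that suits them and the opponent cannot
  leave it, so the initial position decides the game.\<close>

lemma staller_can_win_within_iff:
  assumes G: "pair_graph G"
  shows "staller_can_win_within G first k \<longleftrightarrow> winning_pos G first k []"
proof
  interpret pair_graph G by fact
  have fin: "finite (pverts G)" by (rule pair_finite_verts)
  let ?P = "winning_pos G first k"
  {
    assume "staller_can_win_within G first k"
    then obtain s where s: "legal_strategy G s" and
      win: "\<And>d. legal_strategy G d \<Longrightarrow> \<exists>n \<le> card (pverts G). staller_won G first (play first d s n) \<and>
              card (selected first Staller (play first d s n)) \<le> k"
      unfolding staller_can_win_within_def by blast
    \<comment> \<open>Against this Dominator no position of the play is ever winning for Staller,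
      whereas a win within \<open>k\<close> moves would be such a position.\<close>
    define d where "d = preferring G (\<lambda>h. \<not> ?P h)"
    have d: "legal_strategy G d" unfolding d_def by (rule legal_preferring)
    show "?P []"
    proof (rule ccontr)
      assume lost: "\<not> ?P []"
      have "\<not> ?P (play first d s n)" if "n \<le> card (pverts G)" for n
        using that
      proof (induction n)
        case 0
        then show ?case using lost by simp
      next
        case (Suc n)
        let ?h = "play first d s n"
        have h: "set ?h \<subset> pverts G" "distinct ?h"
          using play_proper[OF d s fin] legal_play[OF d s fin] Suc.prems by auto
        have IH: "\<not> ?P ?h" using Suc by simp
        show ?case
        proof (cases "to_move first n")
          case Dominator
          then have "\<not> ?P (?h @ [d ?h])"
            using preferring(2)[OF h(1), of "\<lambda>h. \<not> ?P h"]
              not_winning_pos_Dominator_move[OF _ IH h(1)]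
            unfolding d_def by simp
          then show ?thesis using Dominator by (simp add: Let_def)
        next
          case Staller
          have "s ?h \<in> pverts G - set ?h"
            using s h unfolding legal_strategy_def by blast
          then have "\<not> ?P (?h @ [s ?h])"
            using not_winning_pos_Staller_move[OF _ IH] Staller by simp
          then show ?thesis using Staller by (simp add: Let_def)
        qed
      qed
      then show False
        using win[OF d] winning_pos_won[of G first _ k] staller_won_iff[OF G] by blast
    qed
  }
  {
    assume init: "?P []"
    define s where "s = preferring G ?P"
    have s: "legal_strategy G s" unfolding s_def by (rule legal_preferring)
    have "\<exists>n \<le> card (pverts G). staller_won G first (play first d s n) \<and>
              card (selected first Staller (play first d s n)) \<le> k"
      if d: "legal_strategy G d" for d
    proof (rule ccontr)
      assume "\<not> ?thesis"
      \<comment> \<open>A winning position already respects the budget \<open>k\<close>, so the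
        failure of the goal means that no closed neighbourhood is owned there.\<close>
      then have no: "\<not> owns_closed_nbhd G (selected first Staller (play first d s n))"
        if "n \<le> card (pverts G)" "?P (play first d s n)" for n
        using that by (auto simp: staller_won_iff[OF G] winning_pos_def Let_def)
      have P: "?P (play first d s n)" if "n \<le> card (pverts G)" for n
        using that
      proof (induction n)
        case 0
        then show ?case using init by simp
      next
        case (Suc n)
        let ?h = "play first d s n"
        have h: "set ?h \<subset> pverts G"
          using play_proper[OF d s fin] Suc.prems by auto
        have IH: "?P ?h" using Suc by simp
        show ?case
        proof (cases "to_move first n")
          case Dominator
          then show ?thesis
            using winning_pos_Dominator_move[OF _ IH] by (simp add: Let_def)
        next
          case Staller
          then have "?P (?h @ [s ?h])"
            using preferring(2)[OF h, of ?P] winning_pos_Staller_move[OF _ IH] no[OF _ IH] Suc.prems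
            unfolding s_def by simp
          then show ?thesis using Staller by (simp add: Let_def)
        qed
      qed
      \<comment> \<open>Once the board is full there is no free vertex, and a forced win must be an
        actual one.\<close>
      let ?h = "play first d s (card (pverts G))"
      have "distinct ?h" "set ?h \<subseteq> pverts G"
        using legal_play[OF d s fin] by auto
      then have "set ?h = pverts G"
        using fin by (metis card_subset_eq distinct_card length_play)
      then have "owns_closed_nbhd G (selected first Staller ?h)"
        using P[of "card (pverts G)"]
        by (auto simp: winning_pos_def Let_def dest: staller_forces_empty split: if_splits)
      then show False using no P by blast
    qed
    then show "staller_can_win_within G first k"
      unfolding staller_can_win_within_def by (intro exI[of _ s] conjI s) auto
  }
qed

lemma staller_can_win_within_D_game:
  assumes "pair_graph G"
  shows "staller_can_win_within G Dominator k \<longleftrightarrow>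
    (\<forall>d. staller_forces (owns_closed_nbhd G) k {} (pverts G - {d}))"
  using staller_can_win_within_iff[OF assms]
  by (simp add: winning_pos_def selected_def to_move_def)

lemma staller_can_win_within_S_game:
  assumes "pair_graph G"
  shows "staller_can_win_within G Staller k \<longleftrightarrow>
    staller_forces (owns_closed_nbhd G) k {} (pverts G)"
  using staller_can_win_within_iff[OF assms]
  by (simp add: winning_pos_def selected_def to_move_def)

text \<open>Dominator's opening move only removes a free vertex, so monotonicity applies.\<close>

lemma S_game_if_D_game:
  assumes "pair_graph G" and "staller_can_win_within G Dominator k"
  shows "staller_can_win_within G Staller k"
  using assms staller_forces_mono[OF _ order_refl Diff_subset]
  by (metis staller_can_win_within_D_game staller_can_win_within_S_game)

section \<open>The corona\<close>

abbreviation copy_part :: "'a \<Rightarrow> ('a + 'a \<times> 'b) set \<Rightarrow> 'b set" where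
  "copy_part g S \<equiv> {x. Inr (g, x) \<in> S}"

lemma owns_closed_nbhd_corona:
  assumes "pair_graph H" and "pverts H \<noteq> {}"
  shows "owns_closed_nbhd (G \<odot> H) S \<longleftrightarrow>
    (\<exists>g \<in> pverts G. Inl g \<in> S \<and> owns_closed_nbhd H (copy_part g S))"
proof
  interpret H: pair_graph H by fact
  assume "owns_closed_nbhd (G \<odot> H) S"
  then obtain v where v: "v \<in> pverts (G \<odot> H)" "v \<in> S"
    "\<And>u. (u, v) \<in> parcs (G \<odot> H) \<Longrightarrow> u \<in> S"
    unfolding owns_closed_nbhd_def by blast
  show "\<exists>g \<in> pverts G. Inl g \<in> S \<and> owns_closed_nbhd H (copy_part g S)"
  proof (cases v)
    \<comment> \<open>The closed neighbourhood of \<open>Inl g\<close> contains the whole copy, and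
      therefore that of any vertex of the nonempty \<open>H\<close>.\<close>
    case (Inl g)
    then have g: "g \<in> pverts G" using v(1) by (auto simp: corona_def)
    have "Inr (g, x) \<in> S" if "x \<in> pverts H" for x
      using v(3)[of "Inr (g, x)"] that g Inl by (auto simp: corona_def)
    then have "owns_closed_nbhd H (copy_part g S)"
      using assms(2) H.in_arcsD1 unfolding owns_closed_nbhd_def by blast
    then show ?thesis using g v(2) Inl by blast
  next
    case (Inr p)
    then obtain g x where p: "v = Inr (g, x)" "g \<in> pverts G" "x \<in> pverts H"
      using v(1) by (auto simp: corona_def)
    have "Inl g \<in> S" using v(3)[of "Inl g"] p by (auto simp: corona_def)
    moreover have "Inr (g, y) \<in> S" if "(y, x) \<in> parcs H" for y
      using v(3)[of "Inr (g, y)"] p that by (auto simp: corona_def)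
    ultimately show ?thesis
      using p v(2) unfolding owns_closed_nbhd_def by blast
  qed
next
  assume "\<exists>g \<in> pverts G. Inl g \<in> S \<and> owns_closed_nbhd H (copy_part g S)"
  then obtain g x where gx: "g \<in> pverts G" "Inl g \<in> S" "x \<in> pverts H" "Inr (g, x) \<in> S"
    "\<And>y. (y, x) \<in> parcs H \<Longrightarrow> Inr (g, y) \<in> S"
    unfolding owns_closed_nbhd_def by blast
  have "u \<in> S" if "(u, Inr (g, x)) \<in> parcs (G \<odot> H)" for u
    using that gx by (auto simp: corona_def)
  moreover have "Inr (g, x) \<in> pverts (G \<odot> H) \<inter> S"
    using gx by (auto simp: corona_def)
  ultimately show "owns_closed_nbhd (G \<odot> H) S"
    unfolding owns_closed_nbhd_def by blast
qed

section \<open>The upper bound\<close>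

lemma corona_D_game_upper:
  fixes G :: "'a pair_pre_digraph" and H :: "'b pair_pre_digraph"
  assumes H: "pair_graph H" "pverts H \<noteq> {}" and G: "pair_graph G" "card (pverts G) \<ge> 2"
    and win: "staller_can_win_within H Dominator k"
  shows "staller_can_win_within (G \<odot> H) Dominator (Suc k)"
proof -
  let ?W = "owns_closed_nbhd (G \<odot> H)" and ?V = "pverts (G \<odot> H)"
  have "staller_forces ?W (Suc k) {} (?V - {d})" for d
  proof -
    obtain g1 g2 where g12: "g1 \<in> pverts G" "g2 \<in> pverts G" "g1 \<noteq> g2"
      using G(2) card_le_Suc0_iff_eq[of "pverts G"] by (cases "finite (pverts G)") force+
    \<comment> \<open>Dominator's opening \<open>d\<close> meets at most one vertex together with
      its copy, so one of two vertices is untouched.\<close>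
    obtain g where g: "g \<in> pverts G" "d \<noteq> Inl g" "\<And>x. d \<noteq> Inr (g, x)"
    proof (cases "d = Inl g1 \<or> (\<exists>x. d = Inr (g1, x))")
      case True
      then show ?thesis using that[OF g12(2)] g12(3) by auto
    next
      case False
      then show ?thesis using that[OF g12(1)] by auto
    qed
    have "staller_forces ?W k {Inl g} (?V - {d} - {Inl g} - {e})" for e
    proof -
      define f where "f = (\<lambda>x :: 'b. Inr (g, x) :: 'a + 'a \<times> 'b)"
      \<comment> \<open>Dominator's reply \<open>e\<close> to \<open>Inl g\<close> counts as his
        opening move in the D-game on this copy; if \<open>e\<close> lies elsewhere,
        \<open>x\<close> is arbitrary.\<close>
      define x where "x = inv f e"
      have inj: "inj f" by (simp add: inj_def f_def)
      have "?W (f ` S \<union> {Inl g})" if "owns_closed_nbhd H S" for S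
      proof -
        have "copy_part g (f ` S \<union> {Inl g}) = S" by (auto simp: f_def)
        then show ?thesis
          using owns_closed_nbhd_corona[OF H] g(1) that by fastforce
      qed
      moreover have "staller_forces (owns_closed_nbhd H) k {} (pverts H - {x})"
        using win staller_can_win_within_D_game[OF H(1)] by blast
      moreover have "f ` (pverts H - {x}) \<subseteq> ?V - {d} - {Inl g} - {e}"
      proof
        fix y assume "y \<in> f ` (pverts H - {x})"
        then obtain z where z: "y = f z" "z \<in> pverts H" "z \<noteq> x" by blast
        have "y \<noteq> e" using z inj x_def by auto
        moreover have "y \<in> ?V - {d} - {Inl g}"
          using g z by (auto simp: f_def corona_def)
        ultimately show "y \<in> ?V - {d} - {Inl g} - {e}" by blast
      qed
      ultimately show ?thesis
        using staller_forces_embed[OF inj, of "owns_closed_nbhd H" ?W "{Inl g}" k "{}"] by simp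
    qed
    moreover have "Inl g \<in> ?V - {d}" using g by (auto simp: corona_def)
    ultimately show ?thesis by auto
  qed
  then show ?thesis
    using staller_can_win_within_D_game[OF pair_graph_corona[OF G(1) H(1)]] by blast
qed

section \<open>The lower bound\<close>

text \<open>
  The invariant Dominator maintains when Staller is to move: in every copy, either \<open>g\<close> is his, or
  the copy has no Staller vertex, or Staller owns \<open>g\<close> but is too slow in the copy.
\<close>

lemma corona_Dominator_defends:
  fixes G :: "'a pair_pre_digraph" and H :: "'b pair_pre_digraph"
  assumes H: "pair_graph H" "pverts H \<noteq> {}"
  shows "\<not> staller_forces (owns_closed_nbhd H) (k - 1) {} (pverts H - {d0}) \<Longrightarrow>
    A \<subseteq> pverts (G \<odot> H) \<Longrightarrow>
    (\<And>g. g \<in> pverts G \<Longrightarrow>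
      Inl g \<notin> S \<and> (Inl g \<notin> A \<or> copy_part g S = {}) \<or>
      Inl g \<in> S \<and> \<not> staller_forces (owns_closed_nbhd H) k (copy_part g S) (copy_part g A)) \<Longrightarrow>
    \<not> staller_forces (owns_closed_nbhd (G \<odot> H)) k S A"
proof (induction k arbitrary: S A)
  case 0
  have "\<not> owns_closed_nbhd (G \<odot> H) S"
    unfolding owns_closed_nbhd_corona[OF H] using "0.prems"(3) by auto
  then show ?case by simp
next
  case (Suc k)
  let ?F = "staller_forces (owns_closed_nbhd H)"
  let ?F' = "staller_forces (owns_closed_nbhd (G \<odot> H))"
  let ?I = "\<lambda>k S A g. Inl g \<notin> S \<and> (Inl g \<notin> A \<or> copy_part g S = {}) \<or>
    Inl g \<in> S \<and> \<not> ?F k (copy_part g S) (copy_part g A)"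
  have inv: "?I (Suc k) S A g" if "g \<in> pverts G" for g
    using Suc.prems(3)[OF that] .
  have "\<not> owns_closed_nbhd (G \<odot> H) S"
    unfolding owns_closed_nbhd_corona[OF H] using inv staller_forces_won by blast
  moreover have "\<exists>d. \<not> ?F' k (insert s S) (A - {s} - {d})" if s: "s \<in> A" for s
  proof -
    \<comment> \<open>The vertex \<open>d0\<close> is an opening in \<open>H\<close> that holds out
      against \<open>k\<close> Staller moves, one fewer than the current budget \<open>Suc k\<close>
      because taking \<open>Inl g\<close> costs her a move. The weaker form with
      \<open>k - 1\<close> feeds the induction.\<close>
    have d0: "\<not> ?F (k - 1) {} (pverts H - {d0})" "\<not> ?F k {} (pverts H - {d0})"
      using Suc.prems(1) staller_forces_mono[OF _ diff_le_self order_refl, of _ k] by auto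
    have copy_sub: "copy_part g A \<subseteq> pverts H" for g
      using Suc.prems(2) by (auto simp: corona_def)
    have weaken: "?I k T B g"
      if "?I (Suc k) S A g" and "B \<subseteq> A"
        and "Inl g \<in> T \<longleftrightarrow> Inl g \<in> S" and "copy_part g T = copy_part g S" for T B g
    proof -
      have "copy_part g B \<subseteq> copy_part g A" using that(2) by blast
      then have "?F (Suc k) (copy_part g S) (copy_part g A)"
        if "?F k (copy_part g S) (copy_part g B)"
        by (rule staller_forces_mono[OF that le_SucI[OF order_refl]])
      with that show ?thesis by (auto simp del: staller_forces.simps)
    qed
    obtain g where g: "g \<in> pverts G" "s = Inl g \<or> (\<exists>x. s = Inr (g, x))"
      using s Suc.prems(2) by (auto simp: corona_def)
    have others: "?I k (insert s S) (A - {s} - {d}) g'" if "g' \<in> pverts G" "g' \<noteq> g" for g' d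
      by (rule weaken[OF inv]) (use that g(2) in auto)
    \<comment> \<open>It suffices to repair the invariant at the one \<open>g\<close> where Staller
      moved.\<close>
    have step: ?thesis if "?I k (insert s S) (A - {s} - {d}) g" for d
    proof -
      have "A - {s} - {d} \<subseteq> pverts (G \<odot> H)" using Suc.prems(2) by blast
      moreover have "?I k (insert s S) (A - {s} - {d}) g'" if "g' \<in> pverts G" for g'
        by (cases "g' = g") (simp only: \<open>?I k (insert s S) (A - {s} - {d}) g\<close>, rule others[OF that])
      ultimately show ?thesis using Suc.IH[OF d0(1)] by blast
    qed
    consider "s \<in> S" | "s = Inl g" "Inl g \<notin> S" | x where "s = Inr (g, x)" "Inl g \<in> S"
      | x where "s = Inr (g, x)" "Inl g \<notin> S"
      using g(2) by blast
    then show ?thesis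
    proof cases
      \<comment> \<open>\<open>S\<close> and \<open>A\<close> need not be disjoint. A repeated move
        gains Staller nothing, and Dominator passes by replying \<open>s\<close>.\<close>
      case 1
      then have "insert s S = S" by blast
      then show ?thesis
        by (intro step[of s] weaken[OF inv[OF g(1)]]) auto
    next
      \<comment> \<open>As \<open>Inl g\<close> was free, the invariant says that Staller has
        nothing in this copy, so Dominator opens there with \<open>d0\<close>.\<close>
      case 2
      then have "copy_part g (insert s S) = {}"
        using inv[OF g(1)] s by auto
      moreover have "\<not> ?F k {} (copy_part g (A - {s} - {Inr (g, d0)}))"
      proof
        assume "?F k {} (copy_part g (A - {s} - {Inr (g, d0)}))"
        then have "?F k {} (pverts H - {d0})"
          by (rule staller_forces_mono) (use copy_sub[of g] in auto)
        then show False using d0(2) by contradiction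
      qed
      ultimately show ?thesis
        using 2 by (intro step[of "Inr (g, d0)"]) simp
    next
      \<comment> \<open>Dominator answers inside the copy with the reply that refutes the move
        \<open>x\<close> in \<open>H\<close>.\<close>
      case (3 x)
      then have "\<not> ?F (Suc k) (copy_part g S) (copy_part g A)"
        using inv[OF g(1)] by blast
      then obtain d where
        d: "\<not> ?F k (insert x (copy_part g S)) (copy_part g A - {x} - {d})"
        using s 3 by auto
      have "copy_part g (insert s S) = insert x (copy_part g S)"
        "copy_part g (A - {s} - {Inr (g, d)}) = copy_part g A - {x} - {d}"
        using 3 by auto
      then show ?thesis
        using d 3 by (intro step[of "Inr (g, d)"]) simp
    next
      \<comment> \<open>Removing \<open>Inl g\<close> from the free vertices puts this copy out of
        Staller's reach for good.\<close>
      case (4 x)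
      then show ?thesis by (intro step[of "Inl g"]) simp
    qed
  qed
  ultimately show ?case by auto
qed

lemma corona_S_game_lower:
  assumes H: "pair_graph H" "pverts H \<noteq> {}" and G: "pair_graph G"
    and win: "staller_can_win_within (G \<odot> H) Staller k"
  shows "\<exists>j. k = Suc j \<and> staller_can_win_within H Dominator j"
proof -
  have "staller_forces (owns_closed_nbhd (G \<odot> H)) k {} (pverts (G \<odot> H))"
    using win staller_can_win_within_S_game[OF pair_graph_corona[OF G H(1)]] by blast
  \<comment> \<open>Contrapositive of the defence: initially Staller owns nothing, so the invariant
    holds everywhere, and an opening \<open>d\<close> refuting her in \<open>H\<close> would refute
    her in the corona.\<close>
  then have "staller_forces (owns_closed_nbhd H) (k - 1) {} (pverts H - {d})" for d
    using corona_Dominator_defends[OF H, of k d "pverts (G \<odot> H)" G "{}"] by auto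
  then have *: "staller_can_win_within H Dominator (k - 1)"
    using staller_can_win_within_D_game[OF H(1)] by blast
  \<comment> \<open>The empty set contains no closed neighbourhood, so \<open>k - 1\<close> is a
    genuine predecessor.\<close>
  have "k \<noteq> 0"
    using \<open>staller_forces _ k {} _\<close> by (cases k) (auto simp: owns_closed_nbhd_def)
  then show ?thesis using * by (metis Suc_pred' bot_nat_0.not_eq_extremum diff_Suc_1)
qed

text \<open>If \<open>P\<close> holds somewhere, both infima are attained and the least elements
  differ by one; otherwise both sides are infinite.\<close>

lemma Inf_enat_Suc:
  "Inf {enat k | k. \<exists>j. k = Suc j \<and> P j} = 1 + Inf {enat j | j. P j}"
proof (cases "\<exists>j. P j")
  case True
  have *: "Inf {enat j | j. Q j} = enat (LEAST j. Q j)" if "Q i" for Q :: "nat \<Rightarrow> bool" and i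
    by (rule antisym) (auto intro!: Inf_lower Inf_greatest LeastI[of Q, OF that] intro: Least_le)
  obtain i where i: "P i" using True by blast
  have "(LEAST k. \<exists>j. k = Suc j \<and> P j) = Suc (LEAST j. P j)"
    by (rule Least_equality) (auto intro: LeastI[of P, OF i] Least_le)
  then show ?thesis
    using *[of P, OF i] *[of "\<lambda>k. \<exists>j. k = Suc j \<and> P j" "Suc i"] i
    by (simp add: one_enat_def)
next
  case False
  then show ?thesis by (simp add: top_enat_def)
qed

theorem theorem3p1:
  fixes G :: "'a pair_pre_digraph" and H :: "'b pair_pre_digraph"
  assumes "pair_graph H" and "outcome_S H"
    and "pair_graph G" and "connected (with_proj G)" and "card (pverts G) \<ge> 2"
  shows "gamma_SMB (G \<odot> H) = 1 + gamma_SMB H \<and> gamma_SMB' (G \<odot> H) = 1 + gamma_SMB H"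
proof -
  \<comment> \<open>On the null graph Staller can never own a closed neighbourhood, which
    contradicts \<open>outcome_S H\<close>.\<close>
  have ne: "pverts H \<noteq> {}"
  proof
    assume empty: "pverts H = {}"
    then have "legal_strategy H s" for s
      by (simp add: legal_strategy_def)
    then obtain h where "staller_won H Staller h"
      using assms(2) unfolding outcome_S_def staller_has_winning_strategy_def by blast
    then show False
      using empty by (simp add: staller_won_iff[OF assms(1)] owns_closed_nbhd_def)
  qed
  note up = corona_D_game_upper[OF assms(1) ne assms(3,5)]
  note low = corona_S_game_lower[OF assms(1) ne assms(3)]
  note DS = S_game_if_D_game[OF pair_graph_corona[OF assms(3,1)]]
  \<comment> \<open>The three facts close a cycle: a D-game win on the corona gives an S-game win
    with the same bound, this gives a D-game win on \<open>H\<close> with one move fewer, and that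
    gives back the D-game win on the corona.\<close>
  have "staller_can_win_within (G \<odot> H) Dominator k \<longleftrightarrow>
      (\<exists>j. k = Suc j \<and> staller_can_win_within H Dominator j)"
    and "staller_can_win_within (G \<odot> H) Staller k \<longleftrightarrow>
      (\<exists>j. k = Suc j \<and> staller_can_win_within H Dominator j)" for k
    by (meson up low DS)+
  then show ?thesis
    unfolding gamma_SMB_def gamma_SMB'_def by (simp only: Inf_enat_Suc)
qed

end
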